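(* Let $\theta>1$ and let the aggregation function $t$ be monotone. Then the algorithm $\mathrm{TA}_\theta$ correctly finds a $\theta$-approximation to the top $k$ answers for $t$ (over every database).
   Context: Setting: fix positive integers $m$ and $k$. A database consists of a finite set of $N\ge k$ objects; each object $R$ has $m$ grades (fields) $x_1,\dots,x_m\in[0,1]$. It is presented as $m$ sorted lists $L_1,\dots,L_m$ of length $N$; list $L_i$ contains one entry $(R,x_i)$ for each object $R$, in descending order of $x_i$ (ties in arbitrary order). An aggregation function is a fixed function $t:[0,1]^m\to[0,\infty)$; the overall grade of $R$ is $t(R)=t(x_1,\dots,x_m)$. $t$ is monotone if $t(x_1,\dots,x_m)\le t(x_1',\dots,x_m')$ whenever $x_i\le x_i'$ for every $i$. A $\theta$-approximation to the top $k$ answers for $t$ over a database is a collection of $k$ objects (each along with its overall grade) such that for each $y$ among these $k$ objects and each object $z$ not among them, $\theta\, t(y)\ge t(z)$. Sorted access means reading the next entry of some list, proceeding sequentially from the top; random access means requesting the grade of a given object in a given list, obtained in one step. Algorithm $\mathrm{TA}_\theta$: (1) Do sorted access in parallel to each of the $m$ lists (top entry of each list, then second entry of each list, and so on). As an object $R$ is seen under sorted access in some list, do random access to the other lists to find all its grades, and compute $t(R)$. If this grade is one of the $k$ highest seen, remember $R$ and $t(R)$ (ties broken arbitrarily, only $k$ objects remembered). (2) For each $i$ let $\underline{x}_i$ be the grade of the last object seen under sorted access in $L_i$, and let the threshold value be $\tau=t(\underline{x}_1,\dots,\underline{x}_m)$. As soon as at least $k$ objects have been seen whose grade is at least $\tau/\theta$,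 halt. (3) Output the $k$ seen objects with highest grades, with their grades. *)

theory Defs
  imports "HOL-Analysis.Analysis"
begin

text \<open>
  The number \<open>m\<close> of fields is the cardinality of the index type \<open>'m\<close>.  Grade vectors live in
  \<open>real ^ 'm\<close>, whose library order is componentwise, so \<open>{0..1}\<close> is the cube \<open>[0,1]\<^sup>m\<close> and
  \<open>mono_on {0..1} t\<close> is monotonicity of an aggregation function.
\<close>

definition database ::
  "'o set \<Rightarrow> ('o \<Rightarrow> real ^ 'm) \<Rightarrow> ('m::finite \<Rightarrow> ('o \<times> real) list) \<Rightarrow> bool" where
  "database Obj x L \<longleftrightarrow>
     finite Obj \<and>
     (\<forall>R\<in>Obj. x R \<in> {0..1}) \<and>
     (\<forall>i. length (L i) = card Obj \<and>
          distinct (L i) \<and>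
          set (L i) = (\<lambda>R. (R, x R $ i)) ` Obj \<and>
          sorted_wrt (\<ge>) (map snd (L i)))"

definition theta_approximation ::
  "real \<Rightarrow> nat \<Rightarrow> (real ^ 'm \<Rightarrow> real) \<Rightarrow> 'o set \<Rightarrow> ('o \<Rightarrow> real ^ 'm) \<Rightarrow> ('o \<times> real) set \<Rightarrow> bool" where
  "theta_approximation \<theta> k t Obj x A \<longleftrightarrow>
     (\<exists>Y. Y \<subseteq> Obj \<and> card Y = k \<and> A = (\<lambda>R. (R, t (x R))) ` Y \<and>
          (\<forall>y\<in>Y. \<forall>z\<in>Obj - Y. \<theta> * t (x y) \<ge> t (x z)))"

text \<open>
  \<open>k_highest k A B\<close>: \<open>B\<close> consists of \<open>k\<close> entries of \<open>A\<close> with the highest grades (of all entries,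
  if there are at most \<open>k\<close>).  It is a relation because ties are broken arbitrarily.
\<close>

definition k_highest :: "nat \<Rightarrow> ('o \<times> real) set \<Rightarrow> ('o \<times> real) set \<Rightarrow> bool" where
  "k_highest k A B \<longleftrightarrow>
     B \<subseteq> A \<and> card B = min k (card A) \<and> (\<forall>p\<in>B. \<forall>q\<in>A - B. snd q \<le> snd p)"

definition random_access :: "('o \<times> real) list \<Rightarrow> 'o \<Rightarrow> real" where
  "random_access l R = the (map_of l R)"

text \<open>
  \<open>pos s i\<close> is the number of entries read so far under sorted access from list \<open>i\<close>; \<open>seen s\<close>
  contains the objects seen so far with the overall grades computed for them; \<open>remembered s\<close> is the
  bounded memory, which is also what the algorithm outputs on halting.  The set \<open>seen s\<close> serves only
  to express the halting condition.
\<close>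

record ('o, 'm) ta_state =
  pos :: "'m \<Rightarrow> nat"
  seen :: "('o \<times> real) set"
  remembered :: "('o \<times> real) set"

definition ta_init :: "('o, 'm) ta_state" where
  "ta_init = \<lparr>pos = (\<lambda>_. 0), seen = {}, remembered = {}\<rparr>"

definition bottom_grades :: "('m::finite \<Rightarrow> ('o \<times> real) list) \<Rightarrow> ('o, 'm) ta_state \<Rightarrow> real ^ 'm" where
  "bottom_grades L s = (\<chi> i. snd (L i ! (pos s i - 1)))"

definition threshold ::
  "(real ^ 'm \<Rightarrow> real) \<Rightarrow> ('m::finite \<Rightarrow> ('o \<times> real) list) \<Rightarrow> ('o, 'm) ta_state \<Rightarrow> real" where
  "threshold t L s = t (bottom_grades L s)"

text \<open>
  The halting condition is tested after each completed round of the parallel sorted access, that is,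
  whenever the same number \<open>d > 0\<close> of entries has been read from every list.
\<close>

definition ta_halted ::
  "(real ^ 'm \<Rightarrow> real) \<Rightarrow> real \<Rightarrow> nat \<Rightarrow> ('m::finite \<Rightarrow> ('o \<times> real) list) \<Rightarrow> ('o, 'm) ta_state \<Rightarrow> bool"
where
  "ta_halted t \<theta> k L s \<longleftrightarrow>
     (\<exists>d>0. \<forall>i. pos s i = d) \<and>
     card {R. \<exists>g. (R, g) \<in> seen s \<and> g \<ge> threshold t L s / \<theta>} \<ge> k"

text \<open>
  One step reads the next entry \<open>(R, a)\<close> of some list \<open>i\<close>, obtains the other grades of \<open>R\<close> by random
  access, and updates the memory.  Requiring \<open>pos s i\<close> to be minimal makes the lists advance in
  parallel; the order of the lists within a round is left open.
\<close>

inductive ta_step ::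
  "(real ^ 'm \<Rightarrow> real) \<Rightarrow> real \<Rightarrow> nat \<Rightarrow> ('m::finite \<Rightarrow> ('o \<times> real) list) \<Rightarrow>
   ('o, 'm) ta_state \<Rightarrow> ('o, 'm) ta_state \<Rightarrow> bool"
  for t :: "real ^ 'm \<Rightarrow> real" and \<theta> :: real and k :: nat and L :: "'m::finite \<Rightarrow> ('o \<times> real) list"
where
  access:
    "\<lbrakk> \<not> ta_halted t \<theta> k L s;
       pos s i < length (L i);
       \<forall>j. pos s i \<le> pos s j;
       L i ! pos s i = (R, a);
       g = t (\<chi> j. if j = i then a else random_access (L j) R);
       k_highest k (insert (R, g) (remembered s)) M \<rbrakk>
     \<Longrightarrow> ta_step t \<theta> k L s
           \<lparr>pos = (pos s)(i := Suc (pos s i)), seen = insert (R, g) (seen s), remembered = M\<rparr>"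

text \<open>
  The bounded memory always holds \<open>k\<close> highest of all the objects seen so far.
\<close>

lemma k_highest_insert:
  assumes fin: "finite S" and M: "k_highest k S M" and M': "k_highest k (insert p M) M'"
  shows "k_highest k (insert p S) M'"
proof -
  have MS: "M \<subseteq> S" and cM: "card M = min k (card S)"
    and oM: "\<And>p q. p \<in> M \<Longrightarrow> q \<in> S - M \<Longrightarrow> snd q \<le> snd p"
    using M by (auto simp: k_highest_def)
  have M'S: "M' \<subseteq> insert p M" and cM': "card M' = min k (card (insert p M))"
    and oM': "\<And>a b. a \<in> M' \<Longrightarrow> b \<in> insert p M - M' \<Longrightarrow> snd b \<le> snd a"
    using M' by (auto simp: k_highest_def)
  have finM: "finite M" using MS fin by (rule finite_subset)
  show ?thesis
  proof (cases "card S \<le> k")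
    case True
    then have "M = S" using cM MS fin by (simp add: card_subset_eq)
    then show ?thesis using M' by simp
  next
    case False
    then have cMk: "card M = k" using cM by simp
    have "k \<le> card (insert p M)" using cMk finM by (simp add: card_insert_if)
    then have cM'k: "card M' = k" using cM' by simp
    have le: "snd b \<le> snd a" if a: "a \<in> M'" and b: "b \<in> insert p S - M'" for a b
    proof (cases "b \<in> insert p M")
      case True
      then show ?thesis using oM' a b by blast
    next
      case bn: False
      then have bS: "b \<in> S - M" using b by blast
      show ?thesis
      proof (cases "a \<in> M")
        case True
        then show ?thesis using oM bS by blast
      next
        case an: False
        have "\<not> M \<subseteq> M'"
        proof
          assume "M \<subseteq> M'"
          moreover have "finite M'" using M'S finM by (meson finite_insert finite_subset)
          ultimately have "M = M'" using cMk cM'k by (simp add: card_subset_eq)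
          then show False using a an by simp
        qed
        then obtain c where c: "c \<in> M" "c \<notin> M'" by blast
        then have "snd c \<le> snd a" using oM' a by blast
        moreover have "snd b \<le> snd c" using oM c bS by blast
        ultimately show ?thesis by simp
      qed
    qed
    have "k \<le> card (insert p S)" using False fin by (simp add: card_insert_if)
    then show ?thesis using M'S MS cM'k le by (auto simp: k_highest_def)
  qed
qed

lemma remembered_k_highest:
  assumes "(ta_step t \<theta> k L)\<^sup>*\<^sup>* ta_init s"
  shows "finite (seen s) \<and> k_highest k (seen s) (remembered s)"
  using assms
proof (induction rule: rtranclp_induct)
  case base
  then show ?case by (simp add: ta_init_def k_highest_def)
next
  case (step s s')
  from step.hyps(2) show ?case
    by (cases rule: ta_step.cases) (use step.IH in \<open>auto intro: k_highest_insert\<close>)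
qed

end

theory Submission
  imports Defs
begin

text \<open>
  An object not seen when the lists have been read to a common depth lies below the bottom grade in
  every list, so by monotonicity its overall grade is at most the threshold \<open>\<tau>\<close>.  On halting, at
  least \<open>k\<close> seen objects have grade at least \<open>\<tau> / \<theta>\<close>, hence so do all the \<open>k\<close> remembered ones.
  The algorithm halts because once the lists are exhausted every object has been seen and has grade at
  least \<open>\<tau>\<close>, which is at least \<open>\<tau> / \<theta>\<close> since \<open>t\<close> is nonnegative.
\<close>

section \<open>Selecting the \<open>k\<close> highest entries\<close>

text \<open>Entries are inserted in descending order of grade, so each new one ranks lowest: a
  selection of \<open>k\<close> entries stays valid, and up to \<open>k\<close> entries all are
  taken. This makes a memory update always possible.\<close>

lemma k_highest_exists:
  assumes "finite A"
  shows "\<exists>B. k_highest k A B"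
  using assms
proof (induction A rule: finite_ranking_induct[where f = "\<lambda>p. - snd p"])
  case empty
  then show ?case by (simp add: k_highest_def)
next
  case (insert p S)
  show ?case
  proof (cases "k \<le> card S")
    case True
    obtain B where "k_highest k S B" using insert.IH by blast
    moreover have "k \<le> card (insert p S)"
      using True insert.hyps(1) by (simp add: card_insert_if)
    ultimately have "k_highest k (insert p S) B"
      using True insert.hyps by (auto simp: k_highest_def)
    then show ?thesis ..
  next
    case False
    then have "card (insert p S) \<le> k" using insert.hyps(1) by (simp add: card_insert_if)
    then have "k_highest k (insert p S) (insert p S)" by (simp add: k_highest_def)
    then show ?thesis ..
  qed
qed

text \<open>Were \<open>p\<close> graded below \<open>c\<close>, no entry graded at least
  \<open>c\<close> could be left out of \<open>B\<close>, as it would beat \<open>p\<close>;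
  together with \<open>p\<close> this gives \<open>B\<close> more than \<open>k\<close>
  entries.\<close>

lemma k_highest_ge:
  assumes "finite A" and B: "k_highest k A B" and k: "k \<le> card {p \<in> A. c \<le> snd p}" and "p \<in> B"
  shows "c \<le> snd p"
proof (rule ccontr)
  assume c: "\<not> c \<le> snd p"
  let ?C = "{q \<in> A. c \<le> snd q}"
  have fin: "finite B" using assms(1) B by (auto simp: k_highest_def intro: finite_subset)
  have "insert p ?C \<subseteq> B"
  proof
    fix q
    assume q: "q \<in> insert p ?C"
    show "q \<in> B"
    proof (rule ccontr)
      assume "q \<notin> B"
      then have "q \<in> A - B" "c \<le> snd q" using q \<open>p \<in> B\<close> by auto
      then show False using B \<open>p \<in> B\<close> c unfolding k_highest_def by (meson order.trans)
    qed
  qed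
  then have "card (insert p ?C) \<le> card B" using fin by (rule card_mono[rotated])
  then have "Suc k \<le> card B" using c k assms(1) by simp
  then show False using B by (simp add: k_highest_def)
qed

section \<open>Reading the sorted lists of a database\<close>

lemma database_grades:
  assumes "database Obj x L" and "R \<in> Obj"
  shows "x R \<in> {0..1}"
  using assms unfolding database_def by blast

lemma database_nth:
  assumes "database Obj x L" and "n < card Obj"
  shows "fst (L i ! n) \<in> Obj" and "snd (L i ! n) = x (fst (L i ! n)) $ i"
proof -
  have "L i ! n \<in> (\<lambda>R. (R, x R $ i)) ` Obj"
    using assms nth_mem[of n "L i"] by (auto simp: database_def)
  then show "fst (L i ! n) \<in> Obj" and "snd (L i ! n) = x (fst (L i ! n)) $ i" by auto
qed

lemma database_index:
  assumes "database Obj x L" and "R \<in> Obj"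
  shows "\<exists>n<card Obj. L i ! n = (R, x R $ i)"
proof -
  have "(R, x R $ i) \<in> set (L i)" "length (L i) = card Obj"
    using assms by (auto simp: database_def)
  then show ?thesis by (auto simp: in_set_conv_nth)
qed

lemma database_antimono:
  assumes "database Obj x L" and "n \<le> n'" and "n' < card Obj"
  shows "snd (L i ! n') \<le> snd (L i ! n)"
proof (cases "n = n'")
  case False
  have "sorted_wrt (\<ge>) (map snd (L i))" and "length (L i) = card Obj"
    using assms(1) by (auto simp: database_def)
  then show ?thesis
    using sorted_wrt_nth_less[of "(\<ge>)" "map snd (L i)" n n'] assms(2,3) False by simp
qed simp

lemma random_access_database:
  assumes "database Obj x L" and "R \<in> Obj"
  shows "random_access (L i) R = x R $ i"
proof -
  have s: "set (L i) = (\<lambda>R. (R, x R $ i)) ` Obj" and d: "distinct (L i)"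
    using assms(1) by (auto simp: database_def)
  \<comment> \<open>An entry is determined by its object, so distinct entries have distinct keys and
    \<open>map_of\<close> finds the only entry of \<open>R\<close>.\<close>
  have "distinct (map fst (L i))" using d s by (auto simp: distinct_map inj_on_def)
  moreover have "(R, x R $ i) \<in> set (L i)" using s assms(2) by simp
  ultimately show ?thesis by (simp add: random_access_def)
qed

section \<open>The invariant of a run\<close>

definition seen_objects :: "('m \<Rightarrow> ('o \<times> real) list) \<Rightarrow> ('o, 'm) ta_state \<Rightarrow> 'o set" where
  "seen_objects L s = (\<Union>i. fst ` set (take (pos s i) (L i)))"

lemma seen_objects_subset:
  assumes "database Obj x L"
  shows "seen_objects L s \<subseteq> Obj"
  using assms by (force simp: seen_objects_def database_def dest!: in_set_takeD)

text \<open>The bound on positions gives termination. The equation says that the computed grades are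
  the true ones and ties \<open>seen s\<close> to the prefixes read so far.\<close>

definition ta_invariant ::
  "(real ^ 'm \<Rightarrow> real) \<Rightarrow> 'o set \<Rightarrow> ('o \<Rightarrow> real ^ 'm) \<Rightarrow> ('m::finite \<Rightarrow> ('o \<times> real) list) \<Rightarrow>
    ('o, 'm) ta_state \<Rightarrow> bool"
where
  "ta_invariant t Obj x L s \<longleftrightarrow>
     (\<forall>i. pos s i \<le> card Obj) \<and>
     seen s = (\<lambda>R. (R, t (x R))) ` seen_objects L s"

lemma ta_step_invariant:
  assumes db: "database Obj x L" and inv: "ta_invariant t Obj x L s" and step: "ta_step t \<theta> k L s s'"
  shows "ta_invariant t Obj x L s'"
  using step
proof cases
  case (access i R a g M)
  have len: "length (L i) = card Obj" using db by (simp add: database_def)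
  then have lt: "pos s i < card Obj" using access by simp
  have R: "R \<in> Obj" and a: "a = x R $ i"
    using database_nth[OF db lt, of i] access(5) by auto
  have "(\<chi> j. if j = i then a else random_access (L j) R) = x R"
    using random_access_database[OF db R] a by (simp add: vec_eq_iff)
  then have g: "g = t (x R)" using access by simp
  \<comment> \<open>Only the prefix of list \<open>i\<close> grows, by the entry at index
    \<open>pos s i\<close>.\<close>
  have "seen_objects L s' = insert R (seen_objects L s)"
    using access(1,3,5) unfolding seen_objects_def
    by (auto simp: take_Suc_conv_app_nth split: if_splits) (metis fst_conv image_eqI)+
  then show ?thesis using inv access(1) g lt by (auto simp: ta_invariant_def)
qed

lemma ta_reachable_invariant:
  assumes "database Obj x L" and "(ta_step t \<theta> k L)\<^sup>*\<^sup>* ta_init s"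
  shows "ta_invariant t Obj x L s"
  using assms(2)
proof (induction rule: rtranclp_induct)
  case base
  then show ?case by (simp add: ta_invariant_def ta_init_def seen_objects_def)
next
  case (step s s')
  then show ?case using ta_step_invariant[OF assms(1)] by blast
qed

section \<open>Termination\<close>

lemma sum_pos_ta_step:
  fixes L :: "'m::finite \<Rightarrow> ('o \<times> real) list"
  assumes "ta_step t \<theta> k L s s'"
  shows "(\<Sum>i\<in>UNIV. pos s' i) = Suc (\<Sum>i\<in>UNIV. pos s i)"
  using assms
proof cases
  case (access i R a g M)
  have "(\<Sum>j\<in>UNIV. pos s' j) = (\<Sum>j\<in>UNIV. pos s j + (if j = i then 1 else 0))"
    using access(1) by (intro sum.cong) auto
  then show ?thesis by (simp add: sum.distrib)
qed

text \<open>After \<open>n\<close> steps the positions sum to \<open>n\<close>, yet the invariant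
  bounds each of the \<open>CARD('m)\<close> positions by \<open>card Obj\<close>.\<close>

lemma no_infinite_ta_run:
  fixes L :: "'m::finite \<Rightarrow> ('o \<times> real) list"
  assumes db: "database Obj x L" and init: "run 0 = ta_init"
    and step: "\<And>n. ta_step t \<theta> k L (run n) (run (Suc n))"
  shows False
proof -
  have reach: "(ta_step t \<theta> k L)\<^sup>*\<^sup>* ta_init (run n)" for n
    by (induction n) (use init step in \<open>auto intro: rtranclp.rtrancl_into_rtrancl\<close>)
  have sum: "(\<Sum>i\<in>UNIV. pos (run n) i) = n" for n
    by (induction n) (auto simp: init ta_init_def sum_pos_ta_step[OF step])
  have "(\<Sum>i\<in>UNIV. pos (run n) i) \<le> CARD('m) * card Obj" for n
    using ta_reachable_invariant[OF db reach[of n]] sum_bounded_above[of UNIV "pos (run n)" "card Obj"]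
    by (simp add: ta_invariant_def)
  from this[of "Suc (CARD('m) * card Obj)"] show False unfolding sum by simp
qed

section \<open>Bottom grades at a common depth\<close>

text \<open>Monotonicity of \<open>t\<close> turns these facts into statements about the threshold:
  the first makes it applicable, the second serves correctness, the third serves halting.\<close>

lemma bottom_grades_database:
  assumes db: "database Obj x L" and pos: "\<And>i. pos s i = d" and "0 < d" and "d \<le> card Obj"
  shows "bottom_grades L s \<in> {0..1}"
    and "R \<in> Obj \<Longrightarrow> R \<notin> seen_objects L s \<Longrightarrow> x R \<le> bottom_grades L s"
    and "d = card Obj \<Longrightarrow> R \<in> Obj \<Longrightarrow> bottom_grades L s \<le> x R"
proof -
  \<comment> \<open>After \<open>d > 0\<close> reads the last entry read has index
    \<open>d - 1\<close>.\<close>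
  have d: "d - 1 < card Obj" using assms(3,4) by simp
  have bottom: "bottom_grades L s $ i = snd (L i ! (d - 1))" for i
    by (simp add: bottom_grades_def pos)
  have "bottom_grades L s $ i \<in> {0..1}" for i
  proof -
    have "x (fst (L i ! (d - 1))) \<in> {0..1}"
      using database_nth(1)[OF db d] db by (simp add: database_def)
    then show ?thesis using database_nth(2)[OF db d, of i] bottom[of i]
      by (simp add: less_eq_vec_def)
  qed
  then show "bottom_grades L s \<in> {0..1}" by (simp add: less_eq_vec_def)
  show "x R \<le> bottom_grades L s" if R: "R \<in> Obj" "R \<notin> seen_objects L s"
  proof -
    have "x R $ i \<le> snd (L i ! (d - 1))" for i
    proof -
      obtain n where n: "n < card Obj" "L i ! n = (R, x R $ i)"
        using database_index[OF db R(1)] by blast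
      \<comment> \<open>An entry at an index below \<open>d\<close> lies in the prefix read, which
        would make \<open>R\<close> seen.\<close>
      have "d \<le> n"
      proof (rule ccontr)
        assume "\<not> d \<le> n"
        then have "(R, x R $ i) \<in> set (take (pos s i) (L i))"
          using n db by (auto simp: pos in_set_conv_nth database_def intro!: exI[of _ n])
        then show False using R(2) by (force simp: seen_objects_def)
      qed
      then show ?thesis using database_antimono[OF db _ n(1), of "d - 1" i] n(2) by simp
    qed
    then show ?thesis by (simp add: less_eq_vec_def bottom)
  qed
  show "bottom_grades L s \<le> x R" if "d = card Obj" and R: "R \<in> Obj"
  proof -
    have "snd (L i ! (d - 1)) \<le> x R $ i" for i
    proof -
      obtain n where n: "n < card Obj" "L i ! n = (R, x R $ i)"
        using database_index[OF db R] by blast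
      \<comment> \<open>At full depth \<open>d - 1\<close> is the last index, so descending order
        makes its grade the minimum of the list.\<close>
      then show ?thesis
        using database_antimono[OF db _ d, of n i] \<open>d = card Obj\<close> by simp
    qed
    then show ?thesis by (simp add: less_eq_vec_def bottom)
  qed
qed

section \<open>Halting and correctness\<close>

text \<open>Short of halting, a run can get stuck only for lack of unread entries, and exhausted
  lists meet the halting condition.\<close>

lemma ta_stuck_halted:
  fixes L :: "'m::finite \<Rightarrow> ('o \<times> real) list"
  assumes "\<theta> \<ge> 1" and t0: "t \<in> {0..1} \<rightarrow> {0..}" and mono: "mono_on {0..1} t"
    and "k \<ge> 1" and k: "card Obj \<ge> k" and db: "database Obj x L"
    and reach: "(ta_step t \<theta> k L)\<^sup>*\<^sup>* ta_init s" and stuck: "\<nexists>s'. ta_step t \<theta> k L s s'"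
  shows "ta_halted t \<theta> k L s"
proof (rule ccontr)
  assume nh: "\<not> ta_halted t \<theta> k L s"
  have inv: "ta_invariant t Obj x L s" using db reach by (rule ta_reachable_invariant)
  have len: "length (L i) = card Obj" for i using db by (simp add: database_def)
  have pos: "pos s i = card Obj" for i
  proof (rule ccontr)
    assume ne: "pos s i \<noteq> card Obj"
    \<comment> \<open>A list of least position may be read next, and it has an unread entry as soon
      as any list has one.\<close>
    obtain i0 where i0: "\<forall>j. pos s i0 \<le> pos s j"
      using ex_has_least_nat[of "\<lambda>_. True" i "pos s"] by blast
    have "pos s i < card Obj" using ne inv by (simp add: ta_invariant_def order.not_eq_order_implies_strict)
    then have "pos s i0 < card Obj" using i0 le_less_trans by blast
    then have lt: "pos s i0 < length (L i0)" by (simp add: len)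
    obtain R a where Ra: "L i0 ! pos s i0 = (R, a)" by fastforce
    let ?g = "t (\<chi> j. if j = i0 then a else random_access (L j) R)"
    have "finite (insert (R, ?g) (remembered s))"
      using remembered_k_highest[OF reach] by (auto simp: k_highest_def intro: finite_subset)
    then obtain M where "k_highest k (insert (R, ?g) (remembered s)) M"
      using k_highest_exists by blast
    from ta_step.access[OF nh lt i0 Ra refl this] stuck show False by blast
  qed
  \<comment> \<open>Halting asks for a common depth \<open>d > 0\<close>; the full depth qualifies
    because \<open>Obj\<close> is nonempty.\<close>
  have c0: "0 < card Obj" using assms(4) k by simp
  note bot = bottom_grades_database[OF db pos c0 order.refl]
  have seen: "seen_objects L s = Obj"
  proof
    show "Obj \<subseteq> seen_objects L s"
      using db by (force simp: seen_objects_def pos database_def)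
  qed (rule seen_objects_subset[OF db])
  have "threshold t L s / \<theta> \<le> t (x R)" if R: "R \<in> Obj" for R
  proof -
    have "0 \<le> threshold t L s" using funcset_mem[OF t0 bot(1)] by (simp add: threshold_def)
    then have "threshold t L s / \<theta> \<le> threshold t L s"
      using \<open>\<theta> \<ge> 1\<close> by (simp add: divide_le_eq mult_left_le mult_le_cancel_left1)
    also have "\<dots> \<le> t (x R)"
      unfolding threshold_def
      using mono bot(1) database_grades[OF db R] bot(3)[OF refl R] by (rule mono_onD)
    finally show ?thesis .
  qed
  then have "{R. \<exists>g. (R, g) \<in> seen s \<and> g \<ge> threshold t L s / \<theta>} = Obj"
    using inv seen by (auto simp: ta_invariant_def)
  then show False using nh pos k c0 by (auto simp: ta_halted_def)
qed

text \<open>A rival \<open>z\<close> outside the output either was seen and ranked no higher than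
  \<open>y\<close>, or is unseen and bounded by the threshold. Only the second case costs the factor
  \<open>\<theta>\<close>.\<close>

lemma ta_halted_theta_approximation:
  fixes L :: "'m::finite \<Rightarrow> ('o \<times> real) list"
  assumes "\<theta> \<ge> 1" and t0: "t \<in> {0..1} \<rightarrow> {0..}" and mono: "mono_on {0..1} t"
    and db: "database Obj x L"
    and reach: "(ta_step t \<theta> k L)\<^sup>*\<^sup>* ta_init s" and halted: "ta_halted t \<theta> k L s"
  shows "theta_approximation \<theta> k t Obj x (remembered s)"
proof -
  let ?f = "\<lambda>R. (R, t (x R))"
  let ?c = "threshold t L s / \<theta>"
  have inv: "ta_invariant t Obj x L s" using db reach by (rule ta_reachable_invariant)
  then have seen: "seen s = ?f ` seen_objects L s" by (simp add: ta_invariant_def)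
  have fin: "finite (seen s)" and kh: "k_highest k (seen s) (remembered s)"
    using remembered_k_highest[OF reach] by auto
  obtain d where d: "d > 0" "\<And>i. pos s i = d"
    using halted by (auto simp: ta_halted_def)
  have "d \<le> card Obj" using inv d(2) by (metis ta_invariant_def)
  note bot = bottom_grades_database[OF db d(2,1) this]
  \<comment> \<open>The halting test counts objects while \<open>k_highest_ge\<close> counts
    entries; projecting entries to objects cannot raise the count.\<close>
  have "{R. \<exists>g. (R, g) \<in> seen s \<and> g \<ge> ?c} = fst ` {p \<in> seen s. ?c \<le> snd p}" by force
  then have kc: "k \<le> card {p \<in> seen s. ?c \<le> snd p}"
    using halted fin card_image_le[of "{p \<in> seen s. ?c \<le> snd p}" fst] by (simp add: ta_halted_def)
  also have "\<dots> \<le> card (seen s)" using fin by (intro card_mono) auto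
  finally have card: "card (remembered s) = k" using kh by (simp add: k_highest_def)
  have sub: "remembered s \<subseteq> ?f ` seen_objects L s" using kh seen by (simp add: k_highest_def)
  then obtain Y where Y: "Y \<subseteq> seen_objects L s" "remembered s = ?f ` Y"
    by (auto simp: subset_image_iff)
  have "card Y = k" using card Y(2) by (simp add: card_image inj_on_def)
  moreover have "Y \<subseteq> Obj" using Y(1) seen_objects_subset[OF db] by blast
  moreover have "\<theta> * t (x y) \<ge> t (x z)" if y: "y \<in> Y" and z: "z \<in> Obj - Y" for y z
  proof (cases "z \<in> seen_objects L s")
    case True
    then have "?f z \<in> seen s - remembered s" "?f y \<in> remembered s" using z y Y(2) seen by auto
    then have "snd (?f z) \<le> snd (?f y)" using kh unfolding k_highest_def by blast
    then have "t (x z) \<le> t (x y)" by simp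
    \<comment> \<open>Nonnegativity gives \<open>t (x y) \<le> \<theta> * t (x y)\<close>.\<close>
    moreover have "0 \<le> t (x y)"
      using funcset_mem[OF t0 database_grades[OF db, of y]] y \<open>Y \<subseteq> Obj\<close> by auto
    ultimately show ?thesis
      using \<open>\<theta> \<ge> 1\<close> mult_right_mono[of 1 \<theta> "t (x y)"] by simp
  next
    case False
    have "t (x z) \<le> threshold t L s"
      unfolding threshold_def
      using z by (intro mono_onD[OF mono database_grades[OF db] bot(1) bot(2)[OF _ False]]) simp_all
    moreover have "?c \<le> snd (?f y)"
      using k_highest_ge[OF fin kh kc] y Y(2) by blast
    ultimately show ?thesis using \<open>\<theta> \<ge> 1\<close> by (simp add: field_simps)
  qed
  ultimately show ?thesis using Y(2) by (auto simp: theta_approximation_def)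
qed

theorem theorem6p6:
  fixes t :: "real ^ 'm::finite \<Rightarrow> real"
    and \<theta> :: real
    and k :: nat
    and Obj :: "'o set"
    and x :: "'o \<Rightarrow> real ^ 'm"
    and L :: "'m \<Rightarrow> ('o \<times> real) list"
  assumes "\<theta> > 1"
    and "t \<in> {0..1} \<rightarrow> {0..}"
    and "mono_on {0..1} t"
    and "k \<ge> 1"
    and "card Obj \<ge> k"
    and "database Obj x L"
  shows "(\<nexists>run. run 0 = ta_init \<and> (\<forall>n. ta_step t \<theta> k L (run n) (run (Suc n)))) \<and>
    (\<forall>s. (ta_step t \<theta> k L)\<^sup>*\<^sup>* ta_init s \<and> (\<nexists>s'. ta_step t \<theta> k L s s') \<longrightarrow>
         ta_halted t \<theta> k L s \<and> theta_approximation \<theta> k t Obj x (remembered s))"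
proof (intro conjI allI impI)
  show "\<nexists>run. run 0 = ta_init \<and> (\<forall>n. ta_step t \<theta> k L (run n) (run (Suc n)))"
    using no_infinite_ta_run[OF assms(6)] by blast
next
  fix s
  assume s: "(ta_step t \<theta> k L)\<^sup>*\<^sup>* ta_init s \<and> (\<nexists>s'. ta_step t \<theta> k L s s')"
  have \<theta>: "\<theta> \<ge> 1" using assms(1) by simp
  show halted: "ta_halted t \<theta> k L s"
    using ta_stuck_halted[OF \<theta> assms(2-6)] s by blast
  then show "theta_approximation \<theta> k t Obj x (remembered s)"
    using ta_halted_theta_approximation[OF \<theta> assms(2,3,6)] s by blast
qed

end
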